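(* Let $T$ be a tournament on $n\ge 9$ vertices with $\pi_2(T)>(n-9)/12$. If $i(T)< 2\pi_2(T)-(n+8)/6$, then $T$ is path extendable.
   Context: For distinct vertices $u,v$ of a tournament $T$, $p_2(u,v)$ denotes the number of directed paths of length $2$ (i.e. with $2$ arcs) from $u$ to $v$ in $T$, and $\pi_2(T)=\min\{p_2(u,v) : u,v\in V(T),\ u\neq v\}$. The irregularity of $T$ is $i(T)=\max\{|d^+(u)-d^-(u)| : u\in V(T)\}$. All paths are directed paths. A path $P$ that is not hamiltonian is called extendable if there is a path $P'$ with the same initial and the same terminal vertex as $P$ and $V(P')=V(P)\cup\{w\}$ for some vertex $w\in V(T)\setminus V(P)$. A digraph is path extendable if every nonhamiltonian path of length at least $1$ in it is extendable. *)

theory Defs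
  imports Complex_Main "Graph_Theory.Vertex_Walk"
begin

locale tournament = digraph +
  assumes exactly_one_arc:
    "u \<in> verts G \<Longrightarrow> v \<in> verts G \<Longrightarrow> u \<noteq> v \<Longrightarrow> (u \<rightarrow>\<^bsub>G\<^esub> v) \<longleftrightarrow> \<not> (v \<rightarrow>\<^bsub>G\<^esub> u)"

text \<open>
  Directed paths are the vertex sequences \<^const>\<open>vpath\<close>. As a \<^locale>\<open>digraph\<close> has no
  parallel arcs, these correspond one-to-one to paths given by their arcs.
\<close>

definition p2 :: "('a, 'b) pre_digraph \<Rightarrow> 'a \<Rightarrow> 'a \<Rightarrow> nat" where
  "p2 G u v = card {p. vpath p G \<and> hd p = u \<and> last p = v \<and> vwalk_length p = 2}"

definition pi2 :: "('a, 'b) pre_digraph \<Rightarrow> nat" where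
  "pi2 G = Min {p2 G u v | u v. u \<in> verts G \<and> v \<in> verts G \<and> u \<noteq> v}"

definition irregularity :: "('a, 'b) pre_digraph \<Rightarrow> int" where
  "irregularity G = Max {\<bar>int (out_degree G u) - int (in_degree G u)\<bar> | u. u \<in> verts G}"

definition hamiltonian_path :: "('a, 'b) pre_digraph \<Rightarrow> 'a vwalk \<Rightarrow> bool" where
  "hamiltonian_path G p \<longleftrightarrow> vpath p G \<and> set p = verts G"

definition extendable :: "('a, 'b) pre_digraph \<Rightarrow> 'a vwalk \<Rightarrow> bool" where
  "extendable G p \<longleftrightarrow>
    (\<exists>p' w. vpath p' G \<and> hd p' = hd p \<and> last p' = last p \<and>
      w \<in> verts G - set p \<and> set p' = set p \<union> {w})"

definition path_extendable :: "('a, 'b) pre_digraph \<Rightarrow> bool" where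
  "path_extendable G \<longleftrightarrow>
    (\<forall>p. vpath p G \<and> \<not> hamiltonian_path G p \<and> vwalk_length p \<ge> 1 \<longrightarrow> extendable G p)"

end

theory Submission
  imports Defs
begin

text \<open>
  Let \<open>x\<^sub>1 \<dots> x\<^sub>k\<close> be an unextendable path. No vertex \<open>w\<close> outside it can be inserted
  between consecutive vertices, so \<open>w\<close> has a threshold \<open>t\<close>: it dominates exactly
  \<open>x\<^sub>1, \<dots>, x\<^sub>t\<close>.

  If some threshold satisfies \<open>3 \<le> t \<le> k - 3\<close>, put
  \<open>U = N\<^sup>+(x\<^sub>1) \<union> N\<^sup>+(x\<^sub>2)\<close> and \<open>U' = N\<^sup>-(x\<^bsub>k-1\<^esub>) \<union> N\<^sup>-(x\<^sub>k)\<close>. Rerouting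
  the path through \<open>w\<close> shows that \<open>x\<^sub>c \<in> U\<close> and \<open>x\<^bsub>c-1\<^esub> \<in> U'\<close> exclude each other up to four
  values of \<open>c\<close>, so \<open>|U| + |U'| \<le> n + 3\<close>. On the other hand the 2-paths from \<open>x\<^sub>1\<close> to \<open>x\<^sub>2\<close>
  avoid \<open>N\<^sup>+(x\<^sub>2)\<close>, hence \<open>|U| \<ge> \<pi>\<^sub>2 + d\<^sup>+(x\<^sub>2) + 1\<close>, and dually for \<open>U'\<close>. Together these give
  \<open>i \<ge> 2\<pi>\<^sub>2 - 2\<close>, contrary to assumption.

  Otherwise the outside vertices split into \<open>L\<close> (\<open>t \<le> 2\<close>) and \<open>H\<close> (\<open>t \<ge> k - 2\<close>), and
  \<open>X = {x\<^sub>3, \<dots>, x\<^bsub>k-2\<^esub>}\<close> is dominated by \<open>H\<close> and dominates \<open>L\<close>. Average degrees in \<open>L\<close> and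
  \<open>H\<close> yield \<open>k - 4 \<le> |H| + i\<close> and \<open>k - 4 \<le> |L| + i\<close>, so \<open>k\<close> is at most about \<open>(n + 2i)/3\<close>. All
  2-paths between vertices of \<open>X\<close> stay on the path, so averaging them over \<open>X\<close> shows that \<open>k\<close> is
  at least about \<open>4\<pi>\<^sub>2\<close>. The hypothesis on \<open>i\<close> makes the two bounds incompatible.
\<close>

section \<open>Neighbourhoods and degrees in a tournament\<close>

context tournament
begin

definition out_nbrs :: "'a \<Rightarrow> 'a set" where
  "out_nbrs v = {u. v \<rightarrow> u}"

definition in_nbrs :: "'a \<Rightarrow> 'a set" where
  "in_nbrs v = {u. u \<rightarrow> v}"

lemma mem_out_nbrs [simp]: "u \<in> out_nbrs v \<longleftrightarrow> v \<rightarrow> u"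
  by (simp add: out_nbrs_def)

lemma mem_in_nbrs [simp]: "u \<in> in_nbrs v \<longleftrightarrow> u \<rightarrow> v"
  by (simp add: in_nbrs_def)

lemma out_nbrs_subset: "out_nbrs v \<subseteq> verts G"
  and in_nbrs_subset: "in_nbrs v \<subseteq> verts G"
  by (auto dest: adj_in_verts)

lemma finite_out_nbrs [simp]: "finite (out_nbrs v)"
  and finite_in_nbrs [simp]: "finite (in_nbrs v)"
  using finite_subset[OF out_nbrs_subset] finite_subset[OF in_nbrs_subset] by auto

lemma not_dominates_self [simp]: "\<not> v \<rightarrow> v"
  using adj_not_same by blast

lemma dominates_asym: "u \<rightarrow> v \<Longrightarrow> \<not> v \<rightarrow> u"
  using exactly_one_arc[of u v] adj_in_verts[of u v] not_dominates_self by blast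

lemma dominates_total:
  "u \<in> verts G \<Longrightarrow> v \<in> verts G \<Longrightarrow> u \<noteq> v \<Longrightarrow> \<not> u \<rightarrow> v \<Longrightarrow> v \<rightarrow> u"
  using exactly_one_arc[of u v] by blast

lemma out_degree_eq_card: "out_degree G v = card (out_nbrs v)"
proof -
  have "out_nbrs v = head G ` out_arcs G v"
    by (auto simp: arcs_ends_conv)
  moreover have "inj_on (head G) (out_arcs G v)"
    by (auto intro!: inj_onI no_multi_arcs simp: arc_to_ends_def)
  ultimately show ?thesis
    by (simp add: out_degree_def card_image)
qed

lemma in_degree_eq_card: "in_degree G v = card (in_nbrs v)"
proof -
  have "in_nbrs v = tail G ` in_arcs G v"
    by (auto simp: arcs_ends_conv)
  moreover have "inj_on (tail G) (in_arcs G v)"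
    by (auto intro!: inj_onI no_multi_arcs simp: arc_to_ends_def)
  ultimately show ?thesis
    by (simp add: in_degree_def card_image)
qed

lemma card_nbrs_in_set:
  assumes "X \<subseteq> verts G" and "v \<in> verts G"
  shows "card (in_nbrs v \<inter> X) + card (out_nbrs v \<inter> X) = card (X - {v})"
proof -
  have "X - {v} = (in_nbrs v \<inter> X) \<union> (out_nbrs v \<inter> X)"
    using assms dominates_total by fastforce
  moreover have "(in_nbrs v \<inter> X) \<inter> (out_nbrs v \<inter> X) = {}"
    by (auto dest: dominates_asym)
  ultimately show ?thesis
    by (simp add: card_Un_disjoint)
qed

lemma irregularity_ge:
  assumes "v \<in> verts G"
  shows "\<bar>int (card (out_nbrs v)) - int (card (in_nbrs v))\<bar> \<le> irregularity G"
proof -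
  have "{\<bar>int (out_degree G u) - int (in_degree G u)\<bar> | u. u \<in> verts G}
      = (\<lambda>u. \<bar>int (out_degree G u) - int (in_degree G u)\<bar>) ` verts G"
    by auto
  then show ?thesis
    unfolding irregularity_def using assms
    by (auto intro!: Max_ge simp: out_degree_eq_card in_degree_eq_card)
qed

lemma card_nbrs_sum:
  assumes "v \<in> verts G"
  shows "card (in_nbrs v) + card (out_nbrs v) + 1 = card (verts G)"
proof -
  have "card (in_nbrs v) + card (out_nbrs v) = card (verts G - {v})"
    using card_nbrs_in_set[OF order_refl assms] in_nbrs_subset out_nbrs_subset
    by (simp add: Int_absorb2)
  then show ?thesis
    using card_Suc_Diff1[OF finite_verts assms] by simp
qed

lemma degree_bounds:
  assumes "v \<in> verts G"
  shows "2 * int (card (out_nbrs v)) \<ge> int (card (verts G)) - 1 - irregularity G"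
    and "2 * int (card (in_nbrs v)) \<ge> int (card (verts G)) - 1 - irregularity G"
    and "2 * int (card (out_nbrs v)) \<le> int (card (verts G)) - 1 + irregularity G"
    and "2 * int (card (in_nbrs v)) \<le> int (card (verts G)) - 1 + irregularity G"
  using irregularity_ge[OF assms] card_nbrs_sum[OF assms] by linarith+

section \<open>2-paths as common neighbours\<close>

lemma p2_eq_card:
  assumes "u \<noteq> v"
  shows "p2 G u v = card (out_nbrs u \<inter> in_nbrs v)"
proof -
  have "{p. vpath p G \<and> hd p = u \<and> last p = v \<and> vwalk_length p = 2}
      = (\<lambda>z. [u, z, v]) ` (out_nbrs u \<inter> in_nbrs v)" (is "?L = ?R")
  proof (intro equalityI subsetI)
    fix p assume p: "p \<in> ?L"
    then have "length p = Suc (Suc (Suc 0))" by auto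
    then obtain a b c where "p = [a, b, c]" by (auto simp: length_Suc_conv)
    with p show "p \<in> ?R" by (auto simp: vpath_def vwalk_def)
  next
    fix p assume "p \<in> ?R"
    then obtain z where z: "p = [u, z, v]" "u \<rightarrow> z" "z \<rightarrow> v" by auto
    then have "u \<noteq> z" "z \<noteq> v" by auto
    with z show "p \<in> ?L"
      using assms by (auto simp: vpath_def vwalk_def dest: adj_in_verts)
  qed
  moreover have "inj_on (\<lambda>z. [u, z, v]) (out_nbrs u \<inter> in_nbrs v)"
    by (auto intro: inj_onI)
  ultimately show ?thesis
    by (simp add: p2_def card_image)
qed

lemma pi2_le_card:
  assumes "u \<in> verts G" and "v \<in> verts G" and "u \<noteq> v"
  shows "pi2 G \<le> card (out_nbrs u \<inter> in_nbrs v)"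
proof -
  have "{p2 G u v | u v. u \<in> verts G \<and> v \<in> verts G \<and> u \<noteq> v}
      \<subseteq> (\<lambda>(u, v). p2 G u v) ` (verts G \<times> verts G)"
    by auto
  then have "finite {p2 G u v | u v. u \<in> verts G \<and> v \<in> verts G \<and> u \<noteq> v}"
    by (rule finite_subset) simp
  then have "pi2 G \<le> p2 G u v"
    unfolding pi2_def using assms by (auto intro: Min_le)
  with assms show ?thesis by (simp add: p2_eq_card)
qed

text \<open>The union contains three disjoint pieces: the midpoints of the 2-paths from
  \<open>u\<close> to \<open>v\<close>, which all dominate \<open>v\<close>; the out-neighbours of
  \<open>v\<close>; and \<open>v\<close> itself, which gives the 1.\<close>

lemma pi2_le_card_union_out_nbrs:
  assumes "u \<rightarrow> v"
  shows "pi2 G + card (out_nbrs v) + 1 \<le> card (out_nbrs u \<union> out_nbrs v)"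
proof -
  have uv: "u \<in> verts G" "v \<in> verts G" "u \<noteq> v"
    using assms adj_in_verts by auto
  let ?M = "out_nbrs u \<inter> in_nbrs v"
  have "?M \<inter> insert v (out_nbrs v) = {}"
    by (auto dest: dominates_asym)
  then have "card ?M + card (insert v (out_nbrs v)) = card (?M \<union> insert v (out_nbrs v))"
    by (simp add: card_Un_disjoint)
  also have "\<dots> \<le> card (out_nbrs u \<union> out_nbrs v)"
    using assms by (intro card_mono) auto
  finally show ?thesis
    using pi2_le_card[OF uv] by simp
qed

lemma pi2_le_card_union_in_nbrs:
  assumes "u \<rightarrow> v"
  shows "pi2 G + card (in_nbrs u) + 1 \<le> card (in_nbrs u \<union> in_nbrs v)"
proof -
  have uv: "u \<in> verts G" "v \<in> verts G" "u \<noteq> v"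
    using assms adj_in_verts by auto
  let ?M = "out_nbrs u \<inter> in_nbrs v"
  have "?M \<inter> insert u (in_nbrs u) = {}"
    by (auto dest: dominates_asym)
  then have "card ?M + card (insert u (in_nbrs u)) = card (?M \<union> insert u (in_nbrs u))"
    by (simp add: card_Un_disjoint)
  also have "\<dots> \<le> card (in_nbrs u \<union> in_nbrs v)"
    using assms by (intro card_mono) auto
  finally show ?thesis
    using pi2_le_card[OF uv] by simp
qed

section \<open>Double counting of arcs and 2-paths\<close>

lemma sum_in_eq_sum_out:
  assumes "finite X"
  shows "(\<Sum>v\<in>X. card (in_nbrs v \<inter> X)) = (\<Sum>v\<in>X. card (out_nbrs v \<inter> X))"
proof -
  have "(\<Sum>v\<in>X. card (in_nbrs v \<inter> X)) = (\<Sum>v\<in>X. \<Sum>u\<in>X. if u \<rightarrow> v then 1 else 0)"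
    using assms by (intro sum.cong refl) (simp add: sum.If_cases in_nbrs_def Int_commute)
  also have "\<dots> = (\<Sum>u\<in>X. \<Sum>v\<in>X. if u \<rightarrow> v then 1 else 0)"
    by (rule sum.swap)
  also have "\<dots> = (\<Sum>u\<in>X. card (out_nbrs u \<inter> X))"
    using assms by (intro sum.cong refl) (simp add: sum.If_cases out_nbrs_def Int_commute)
  finally show ?thesis .
qed

text \<open>In-degrees and out-degrees within \<open>X\<close> have the same total, so some vertex
  has in-degree at least its out-degree; the two add up to |X| - 1.\<close>

lemma ex_large_in_degree_within:
  assumes "X \<subseteq> verts G" and "X \<noteq> {}"
  obtains v where "v \<in> X" and "card X \<le> 2 * card (in_nbrs v \<inter> X) + 1"
proof -
  have fin: "finite X" using finite_subset[OF assms(1)] by simp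
  have "\<exists>v\<in>X. card (out_nbrs v \<inter> X) \<le> card (in_nbrs v \<inter> X)"
  proof (rule ccontr)
    assume "\<not> ?thesis"
    then have "(\<Sum>v\<in>X. card (in_nbrs v \<inter> X)) < (\<Sum>v\<in>X. card (out_nbrs v \<inter> X))"
      using fin assms by (intro sum_strict_mono) auto
    with sum_in_eq_sum_out[OF fin] show False by simp
  qed
  then obtain v where v: "v \<in> X" "card (out_nbrs v \<inter> X) \<le> card (in_nbrs v \<inter> X)" by auto
  have "card (in_nbrs v \<inter> X) + card (out_nbrs v \<inter> X) + 1 = card X"
    using card_nbrs_in_set[of X v] card_Suc_Diff1[OF fin v(1)] v(1) assms by auto
  with v that show thesis by auto
qed

lemma ex_large_out_degree_within:
  assumes "X \<subseteq> verts G" and "X \<noteq> {}"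
  obtains v where "v \<in> X" and "card X \<le> 2 * card (out_nbrs v \<inter> X) + 1"
proof -
  have fin: "finite X" using finite_subset[OF assms(1)] by simp
  have "\<exists>v\<in>X. card (in_nbrs v \<inter> X) \<le> card (out_nbrs v \<inter> X)"
  proof (rule ccontr)
    assume "\<not> ?thesis"
    then have "(\<Sum>v\<in>X. card (out_nbrs v \<inter> X)) < (\<Sum>v\<in>X. card (in_nbrs v \<inter> X))"
      using fin assms by (intro sum_strict_mono) auto
    with sum_in_eq_sum_out[OF fin] show False by simp
  qed
  then obtain v where v: "v \<in> X" "card (in_nbrs v \<inter> X) \<le> card (out_nbrs v \<inter> X)" by auto
  have "card (in_nbrs v \<inter> X) + card (out_nbrs v \<inter> X) + 1 = card X"
    using card_nbrs_in_set[of X v] card_Suc_Diff1[OF fin v(1)] v(1) assms by auto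
  with v that show thesis by auto
qed

text \<open>Triples \<open>u\<close>, \<open>z\<close>, \<open>v\<close> are regrouped by their
  midpoint \<open>z\<close>. The diagonal \<open>u = v\<close> adds nothing, as arcs are never
  reversed.\<close>

lemma sum_two_paths:
  assumes "finite X" and "finite Z"
  shows "(\<Sum>u\<in>X. \<Sum>v\<in>X. card (out_nbrs u \<inter> in_nbrs v \<inter> Z))
    = (\<Sum>z\<in>Z. card (in_nbrs z \<inter> X) * card (out_nbrs z \<inter> X))"
proof -
  have "(\<Sum>u\<in>X. \<Sum>v\<in>X. card (out_nbrs u \<inter> in_nbrs v \<inter> Z))
      = (\<Sum>u\<in>X. \<Sum>v\<in>X. \<Sum>z\<in>Z. if u \<rightarrow> z \<and> z \<rightarrow> v then 1 else 0)"
    using assms by (intro sum.cong refl)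
      (auto simp: sum.If_cases intro!: arg_cong[where f = card])
  also have "\<dots> = (\<Sum>u\<in>X. \<Sum>z\<in>Z. \<Sum>v\<in>X. if u \<rightarrow> z \<and> z \<rightarrow> v then 1 else 0)"
    by (intro sum.cong refl sum.swap)
  also have "\<dots> = (\<Sum>z\<in>Z. \<Sum>u\<in>X. \<Sum>v\<in>X. if u \<rightarrow> z \<and> z \<rightarrow> v then 1 else 0)"
    by (rule sum.swap)
  also have "\<dots> = (\<Sum>z\<in>Z. (\<Sum>u\<in>X. if u \<rightarrow> z then 1 else 0) * (\<Sum>v\<in>X. if z \<rightarrow> v then 1 else 0))"
    unfolding sum_product by (intro sum.cong refl) auto
  also have "\<dots> = (\<Sum>z\<in>Z. card (in_nbrs z \<inter> X) * card (out_nbrs z \<inter> X))"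
    using assms by (intro sum.cong refl)
      (simp add: sum.If_cases in_nbrs_def out_nbrs_def Int_commute)
  finally show ?thesis .
qed

end

text \<open>Here walks are joined by a connecting arc rather than at a shared vertex, which suits
  cutting a path into segments and gluing them in another order.\<close>

lemma vwalk_append_iff:
  assumes "p \<noteq> []" and "q \<noteq> []"
  shows "vwalk (p @ q) G \<longleftrightarrow> vwalk p G \<and> vwalk q G \<and> last p \<rightarrow>\<^bsub>G\<^esub> hd q"
  using assms by (auto simp: vwalk_def vwalk_arcs_append)

text \<open>AM-GM; since \<open>div\<close> rounds down, an odd sum gains a quarter.\<close>

lemma mult_le_sum_square_div_4:
  fixes x y :: nat
  shows "x * y \<le> (x + y)\<^sup>2 div 4"
proof -
  have "0 \<le> (int x - int y)\<^sup>2" by simp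
  then have "int (4 * (x * y)) \<le> int ((x + y)\<^sup>2)"
    by (simp add: power2_sum power2_diff)
  then have "4 * (x * y) \<le> (x + y)\<^sup>2" by (simp only: of_nat_le_iff)
  then show ?thesis by simp
qed

section \<open>Insertion, rerouting and thresholds for an unextendable path\<close>

locale unextendable_path = tournament +
  fixes p :: "'a list"
  assumes path: "vpath p G"
    and not_extendable: "\<not> extendable G p"
    and length_ge_2: "2 \<le> length p"
begin

lemma distinct_p: "distinct p"
  and set_subset_verts: "set p \<subseteq> verts G"
  and walk: "vwalk p G"
  using path by (auto simp: vpath_def vwalk_def)

lemma nth_in_verts [simp]: "j < length p \<Longrightarrow> p ! j \<in> verts G"
  using set_subset_verts by auto

lemma not_path_through_new_vertex:
  assumes "vwalk q G" and "distinct q" and "hd q = hd p" and "last q = last p"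
    and "w \<in> verts G - set p" and "set q = insert w (set p)"
  shows False
  using assms not_extendable by (auto simp: extendable_def vpath_def)

lemma take_drop_vwalk:
  assumes "0 < j" and "j < length p"
  shows "vwalk (take j p) G" and "vwalk (drop j p) G"
    and "last (take j p) = p ! (j - 1)" and "hd (drop j p) = p ! j"
    and "hd (take j p) = hd p" and "last (drop j p) = last p"
    and "p ! (j - 1) \<rightarrow> p ! j"
proof -
  have ne: "take j p \<noteq> []" "drop j p \<noteq> []" using assms by auto
  show l: "last (take j p) = p ! (j - 1)" using ne assms by (simp add: last_conv_nth min_def)
  show h: "hd (drop j p) = p ! j" using assms by (simp add: hd_drop_conv_nth)
  show "hd (take j p) = hd p" and "last (drop j p) = last p" using assms by auto
  show "vwalk (take j p) G" and "vwalk (drop j p) G" and "p ! (j - 1) \<rightarrow> p ! j"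
    using walk vwalk_append_iff[OF ne, of G] l h by auto
qed

lemma consecutive: "Suc j < length p \<Longrightarrow> p ! j \<rightarrow> p ! Suc j"
  using take_drop_vwalk(7)[of "Suc j"] by simp

lemma no_insertion:
  assumes w: "w \<in> verts G - set p" and j: "Suc j < length p" and "p ! j \<rightarrow> w"
  shows "\<not> w \<rightarrow> p ! Suc j"
proof
  assume "w \<rightarrow> p ! Suc j"
  let ?A = "take (Suc j) p" and ?B = "drop (Suc j) p"
  note tk = take_drop_vwalk[of "Suc j"]
  have ne: "?A \<noteq> []" "?B \<noteq> []" using j by auto
  have w1: "vwalk [w] G" using w by auto
  have "vwalk ([w] @ ?B) G"
    using ne w1 tk j \<open>w \<rightarrow> p ! Suc j\<close> by (subst vwalk_append_iff) auto
  then have walk': "vwalk (?A @ [w] @ ?B) G"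
    using ne tk j \<open>p ! j \<rightarrow> w\<close> by (subst vwalk_append_iff) auto
  have "set ?A \<inter> set ?B = {}" "set ?A \<union> set ?B = set p" "distinct ?A" "distinct ?B"
    using distinct_p set_append[of ?A ?B] distinct_append[of ?A ?B] by simp_all
  then have "distinct (?A @ [w] @ ?B)" and "set (?A @ [w] @ ?B) = insert w (set p)"
    using w by auto
  moreover have "hd (?A @ [w] @ ?B) = hd p" "last (?A @ [w] @ ?B) = last p"
    using ne tk j by auto
  ultimately show False using not_path_through_new_vertex[OF walk'] w by blast
qed

text \<open>
  The segment from \<open>p ! Suc r\<close> to \<open>p ! (s - 1)\<close> closes up through \<open>w\<close> to a cycle, which is
  entered at \<open>p ! c\<close> and left at \<open>p ! (c - 1)\<close>.
\<close>

lemma no_rerouting: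
  assumes w: "w \<in> verts G - set p"
    and "Suc r < c" and "c < s" and "s < length p"
    and "p ! (s - 1) \<rightarrow> w" and "w \<rightarrow> p ! Suc r" and "p ! r \<rightarrow> p ! c"
  shows "\<not> p ! (c - 1) \<rightarrow> p ! s"
proof
  assume leave: "p ! (c - 1) \<rightarrow> p ! s"
  \<comment> \<open>Cut the path before the indices \<open>Suc r\<close>, \<open>c\<close> and
    \<open>s\<close>.\<close>
  define A where "A = take (Suc r) p"
  define B where "B = take (c - Suc r) (drop (Suc r) p)"
  define C where "C = take (s - c) (drop c p)"
  define D where "D = drop s p"
  have "p = A @ drop (Suc r) p" by (simp add: A_def)
  also have "drop (Suc r) p = B @ drop (c - Suc r) (drop (Suc r) p)"
    unfolding B_def by (rule append_take_drop_id[symmetric])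
  also have "drop (c - Suc r) (drop (Suc r) p) = drop c p" using assms by simp
  also have "drop c p = C @ drop (s - c) (drop c p)"
    unfolding C_def by (rule append_take_drop_id[symmetric])
  also have "drop (s - c) (drop c p) = D" using assms by (simp add: D_def)
  finally have p: "p = A @ B @ C @ D" .
  have ne: "A \<noteq> []" "B \<noteq> []" "C \<noteq> []" "D \<noteq> []"
    using assms by (auto simp: A_def B_def C_def D_def)
  have ends: "last A = p ! r" "hd B = p ! Suc r" "last B = p ! (c - 1)" "hd C = p ! c"
      "last C = p ! (s - 1)" "hd D = p ! s"
    using ne assms by (auto simp: A_def B_def C_def D_def last_conv_nth hd_conv_nth min_def
        numeral_2_eq_2 Suc_diff_Suc simp del: take_eq_Nil drop_eq_Nil)
  have walks: "vwalk A G" "vwalk B G" "vwalk C G" "vwalk D G" "vwalk [w] G"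
    using walk ne w unfolding p by (auto simp: vwalk_append_iff)
  \<comment> \<open>The middle segments swap: \<open>p ! r\<close> jumps to \<open>C\<close>, the
    end of \<open>C\<close> returns through \<open>w\<close> to the start of \<open>B\<close>, and
    \<open>p ! (c - 1)\<close> leaves for \<open>D\<close>.\<close>
  have walk': "vwalk (A @ C @ [w] @ (B @ D)) G"
    using ne walks ends assms leave by (simp add: vwalk_append_iff del: append_Cons)
  have "distinct (A @ C @ [w] @ B @ D)" "set (A @ C @ [w] @ B @ D) = insert w (set p)"
    using distinct_p w unfolding p by auto
  moreover have "hd (A @ C @ [w] @ B @ D) = hd p" "last (A @ C @ [w] @ B @ D) = last p"
    using ne unfolding p by auto
  ultimately show False using not_path_through_new_vertex[OF walk'] w by blast
qed

text \<open>As \<open>p ! j\<close> is 0-indexed, \<open>thr w\<close> is also the number of vertices of \<open>p\<close> dominated by \<open>w\<close>.\<close>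

definition thr :: "'a \<Rightarrow> nat" where
  "thr w = (LEAST j. j = length p \<or> p ! j \<rightarrow> w)"

lemma dominates_nth_iff:
  assumes w: "w \<in> verts G - set p" and j: "j < length p"
  shows "w \<rightarrow> p ! j \<longleftrightarrow> j < thr w"
proof
  assume "j < thr w"
  then have "\<not> p ! j \<rightarrow> w"
    unfolding thr_def using not_less_Least by blast
  then show "w \<rightarrow> p ! j"
    using w j by (metis Diff_iff dominates_total nth_in_verts nth_mem)
next
  \<comment> \<open>The default \<open>length p\<close> keeps \<open>LEAST\<close> meaningful when
    \<open>w\<close> dominates the whole path.\<close>
  have thr: "thr w = length p \<or> p ! thr w \<rightarrow> w"
    unfolding thr_def by (rule LeastI) (rule disjI1, rule refl)
  \<comment> \<open>Once a path vertex dominates \<open>w\<close>, all later ones do; otherwise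
    \<open>w\<close> could be inserted at the first change.\<close>
  have "p ! i \<rightarrow> w" if "thr w \<le> i" "i < length p" for i
    using that
  proof (induction i rule: dec_induct)
    case base
    then show ?case using thr by auto
  next
    case (step i)
    then have "\<not> w \<rightarrow> p ! Suc i" using no_insertion[OF w, of i] by auto
    then show ?case
      using w step.prems by (metis Diff_iff dominates_total nth_in_verts nth_mem)
  qed
  then show "w \<rightarrow> p ! j \<Longrightarrow> j < thr w"
    using j by (meson dominates_asym not_less)
qed

lemma nth_dominates_iff:
  assumes w: "w \<in> verts G - set p" and j: "j < length p"
  shows "p ! j \<rightarrow> w \<longleftrightarrow> thr w \<le> j"
proof -
  have "p ! j \<rightarrow> w \<longleftrightarrow> \<not> w \<rightarrow> p ! j"
    using w j exactly_one_arc[of "p ! j" w] by (metis Diff_iff nth_in_verts nth_mem)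
  then show ?thesis using dominates_nth_iff[OF assms] by auto
qed

section \<open>Minimum length of an unextendable path\<close>

lemma two_paths_of_consecutive_subset:
  assumes "Suc j < length p"
  shows "out_nbrs (p ! j) \<inter> in_nbrs (p ! Suc j) \<subseteq> set p"
proof
  fix z assume z: "z \<in> out_nbrs (p ! j) \<inter> in_nbrs (p ! Suc j)"
  then have "z \<in> verts G" using adj_in_verts(2)[of "p ! j" z] by simp
  then show "z \<in> set p" using no_insertion[OF _ assms, of z] z by auto
qed

text \<open>Midpoints of 2-paths between consecutive vertices lie on the path. Those from
  \<open>p ! 0\<close> to \<open>p ! 1\<close> dominate \<open>p ! 1\<close>, those from
  \<open>p ! 1\<close> to \<open>p ! 2\<close> are dominated by it, so the two sets are disjoint;
  \<open>p ! 0\<close>, \<open>p ! 1\<close> and \<open>p ! 2\<close> make up the 3.\<close>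

lemma length_ge:
  assumes "0 < pi2 G"
  shows "2 * pi2 G + 3 \<le> length p"
proof -
  have neq: "p ! i \<noteq> p ! j" if "i < length p" "j < length p" "i \<noteq> j" for i j
    using distinct_p that by (simp add: nth_eq_iff_index_eq)
  let ?M = "\<lambda>j. out_nbrs (p ! j) \<inter> in_nbrs (p ! Suc j)"
  have card_M: "pi2 G \<le> card (?M j)" if "Suc j < length p" for j
    using that neq by (intro pi2_le_card) auto
  \<comment> \<open>Needed for \<open>p ! 2\<close> to exist: a midpoint between
    \<open>p ! 0\<close> and \<open>p ! 1\<close> is a third path vertex.\<close>
  have "3 \<le> length p"
  proof -
    have "?M 0 \<noteq> {}" using card_M[of 0] assms length_ge_2 by auto
    then obtain z where "z \<in> ?M 0" by blast
    moreover have "p ! 0 \<in> set p" "p ! 1 \<in> set p" using length_ge_2 by (auto intro!: nth_mem)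
    ultimately have "{z, p ! 0, p ! 1} \<subseteq> set p" "z \<noteq> p ! 0" "z \<noteq> p ! 1"
      using two_paths_of_consecutive_subset[of 0] length_ge_2 by auto
    moreover from this have "card {z, p ! 0, p ! 1} \<le> card (set p)"
      by (intro card_mono) simp_all
    moreover have "p ! 0 \<noteq> p ! 1" using length_ge_2 by (intro neq) auto
    ultimately have "3 \<le> card (set p)" by simp
    then show ?thesis using distinct_p by (simp add: distinct_card)
  qed
  then have c: "p ! 0 \<rightarrow> p ! 1" "p ! 1 \<rightarrow> p ! 2"
    using consecutive[of 0] consecutive[of 1] by (auto simp: numeral_2_eq_2)
  let ?A = "insert (p ! 2) (?M 1)" and ?B = "insert (p ! 0) (?M 0)"
  have "card ?A = Suc (card (?M 1))" "card ?B = Suc (card (?M 0))"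
    by (simp_all add: numeral_2_eq_2)
  moreover have disj: "?A \<inter> ?B = {}"
    using c by (auto dest: dominates_asym)
  moreover have "?A \<union> ?B \<subseteq> set p - {p ! 1}"
    using two_paths_of_consecutive_subset[of 0] two_paths_of_consecutive_subset[of 1]
      \<open>3 \<le> length p\<close> neq[of 2 1] neq[of 0 1] length_pos_if_in_set[of _ p]
    by (auto simp del: length_greater_0_conv intro!: nth_mem)
  then have "card (?A \<union> ?B) \<le> card (set p - {p ! 1})"
    by (intro card_mono) auto
  moreover have "card (set p - {p ! 1}) + 1 = length p"
    using distinct_p \<open>3 \<le> length p\<close> by (simp add: distinct_card)
  moreover have "card (?A \<union> ?B) = card ?A + card ?B"
    using disj by (intro card_Un_disjoint) auto
  ultimately show ?thesis
    using card_M[of 0] card_M[of 1] \<open>3 \<le> length p\<close> by linarith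
qed

section \<open>Outside vertices with a middle threshold\<close>

lemma card_eq_card_indices:
  assumes "X \<subseteq> verts G"
  shows "card X = card {j. j < length p \<and> p ! j \<in> X} + card (X - set p)"
proof -
  have "X \<inter> set p = (!) p ` {j. j < length p \<and> p ! j \<in> X}"
    by (auto simp: in_set_conv_nth)
  moreover have "inj_on ((!) p) {j. j < length p \<and> p ! j \<in> X}"
    using distinct_p by (auto intro!: inj_onI simp: nth_eq_iff_index_eq)
  ultimately have "card (X \<inter> set p) = card {j. j < length p \<and> p ! j \<in> X}"
    by (simp add: card_image)
  moreover have "card X = card (X \<inter> set p) + card (X - set p)"
    using finite_subset[OF assms] by (intro card_Int_Diff) simp
  ultimately show ?thesis by simp
qed

lemma card_verts: "card (verts G) = length p + card (verts G - set p)"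
proof -
  have "card (verts G) = card (verts G \<inter> set p) + card (verts G - set p)"
    by (intro card_Int_Diff) simp
  then show ?thesis
    using set_subset_verts distinct_p by (simp add: Int_absorb1 distinct_card)
qed

lemma irregularity_ge_of_middle_thr:
  assumes k: "7 \<le> length p" and w: "w \<in> verts G - set p"
    and mid: "3 \<le> thr w" "thr w + 3 \<le> length p"
  shows "2 * int (pi2 G) \<le> irregularity G + 2"
proof -
  define k where "k = length p"
  have k7: "7 \<le> k" and "p \<noteq> []" using k by (auto simp: k_def)
  define U where "U = out_nbrs (p ! 0) \<union> out_nbrs (p ! 1)"
  define U' where "U' = in_nbrs (p ! (k - 2)) \<union> in_nbrs (p ! (k - 1))"
  define I where "I = {j. j < k \<and> p ! j \<in> U}"
  define I' where "I' = {j. j < k \<and> p ! j \<in> U'}"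
  have suc: "Suc (k - 2) = k - 1" using k7 by simp
  have c: "p ! 0 \<rightarrow> p ! 1" "p ! (k - 2) \<rightarrow> p ! (k - 1)"
    using consecutive[of 0] consecutive[of "k - 2"] k7 suc by (auto simp: k_def)
  have sub: "U \<subseteq> verts G" "U' \<subseteq> verts G"
    unfolding U_def U'_def using in_nbrs_subset out_nbrs_subset by blast+
  have fin: "finite I" "finite I'" by (auto simp: I_def I'_def)
  \<comment> \<open>Rerouting uses \<open>r\<close> in {0, 1} and \<open>s\<close> in {k - 2, k -
    1}; the order \<open>Suc r < j < s\<close> is guaranteed only for \<open>3 <= j < k - 2\<close>,
    whence the four exceptions.\<close>
  have crossing: "I \<inter> Suc ` I' \<subseteq> {1, 2, k - 2, k - 1}"
  proof
    fix j assume j: "j \<in> I \<inter> Suc ` I'"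
    show "j \<in> {1, 2, k - 2, k - 1}"
    proof (rule ccontr)
      assume "j \<notin> {1, 2, k - 2, k - 1}"
      then have j3: "3 \<le> j" "j < k - 2" using j by (auto simp: I_def)
      from j obtain r where r: "r \<le> 1" "p ! r \<rightarrow> p ! j" by (auto simp: I_def U_def)
      from j have "p ! (j - 1) \<in> U'" by (auto simp: I'_def)
      then obtain s where s: "s = k - 2 \<or> s = k - 1" "p ! (j - 1) \<rightarrow> p ! s"
        unfolding U'_def by auto
      \<comment> \<open>Since \<open>s - 1 >= k - 3\<close> and \<open>Suc r <= 2\<close>, the
        bounds in \<open>mid\<close> are exactly what both arcs at \<open>w\<close> require.\<close>
      have "p ! (s - 1) \<rightarrow> w"
        using s mid k7 w by (subst nth_dominates_iff) (auto simp: k_def)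
      moreover have "w \<rightarrow> p ! Suc r"
        using r mid k7 w by (subst dominates_nth_iff) (auto simp: k_def)
      moreover have "Suc r < j" "j < s" "s < length p"
        using r s j3 k7 by (auto simp: k_def)
      ultimately show False
        using no_rerouting[OF w] r s by blast
    qed
  qed
  \<comment> \<open>Excluding the two end indices confines \<open>I\<close> and the shifted
    \<open>I'\<close> to k - 1 values; four overlaps then give k + 3.\<close>
  have "0 \<notin> I"
    using c by (auto simp: I_def U_def dest: dominates_asym)
  moreover have "k - 1 \<notin> I'"
    using c by (auto simp: I'_def U'_def dest: dominates_asym)
  moreover have "I \<subseteq> {..<k}" "I' \<subseteq> {..<k}" by (auto simp: I_def I'_def)
  ultimately have "I \<subseteq> {..<k} - {0}" "I' \<subseteq> {..<k} - {k - 1}" by blast+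
  then have "I \<union> Suc ` I' \<subseteq> {0<..<k}"
    by force
  then have "card (I \<union> Suc ` I') \<le> k - 1"
    using card_mono[of "{0<..<k}"] by fastforce
  moreover have "card (I \<inter> Suc ` I') \<le> card {1, 2, k - 2, k - 1}"
    using crossing by (intro card_mono) auto
  then have "card (I \<inter> Suc ` I') \<le> 4"
    using card_length[of "[1, 2, k - 2, k - 1]"] by simp
  moreover have "card I + card I' = card (I \<union> Suc ` I') + card (I \<inter> Suc ` I')"
    using card_Un_Int[of I "Suc ` I'"] fin by (simp add: card_image)
  ultimately have "card I + card I' \<le> k + 3" using k7 by linarith
  moreover have "card (U - set p) + card (U' - set p) \<le> card (verts G - set p)"
  proof -
    \<comment> \<open>Off the path, membership in \<open>U\<close> forces threshold at most 1,
      membership in \<open>U'\<close> at least k - 1.\<close>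
    have "(U - set p) \<inter> (U' - set p) = {}"
    proof (rule ccontr)
      assume "\<not> ?thesis"
      then obtain z where z: "z \<in> verts G - set p" "z \<in> U" "z \<in> U'" using sub by blast
      have "thr z \<le> 1"
        using z(2) nth_dominates_iff[OF z(1), of 0] nth_dominates_iff[OF z(1), of 1] k7
          \<open>p \<noteq> []\<close> by (auto simp: U_def k_def)
      moreover have "k - 2 < thr z"
        using z(3) dominates_nth_iff[OF z(1), of "k - 2"] dominates_nth_iff[OF z(1), of "k - 1"] k7
          \<open>p \<noteq> []\<close> by (auto simp: U'_def k_def)
      ultimately show False using k7 by simp
    qed
    then have "card (U - set p) + card (U' - set p) = card ((U - set p) \<union> (U' - set p))"
      using sub finite_subset[OF _ finite_verts] by (subst card_Un_disjoint) auto
    also have "\<dots> \<le> card (verts G - set p)"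
      using sub by (intro card_mono) auto
    finally show ?thesis .
  qed
  ultimately have "card U + card U' \<le> card (verts G) + 3"
    using card_eq_card_indices[OF sub(1)] card_eq_card_indices[OF sub(2)] card_verts
    by (simp add: I_def I'_def k_def)
  moreover have "pi2 G + card (out_nbrs (p ! 1)) + 1 \<le> card U"
    unfolding U_def by (rule pi2_le_card_union_out_nbrs) (rule c)
  moreover have "pi2 G + card (in_nbrs (p ! (k - 2))) + 1 \<le> card U'"
    unfolding U'_def by (rule pi2_le_card_union_in_nbrs) (rule c)
  moreover have "2 * int (card (out_nbrs (p ! 1))) \<ge> int (card (verts G)) - 1 - irregularity G"
    "2 * int (card (in_nbrs (p ! (k - 2)))) \<ge> int (card (verts G)) - 1 - irregularity G"
    using k7 by (auto intro!: degree_bounds simp: k_def)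
  ultimately show ?thesis by linarith
qed

section \<open>Outside vertices with extreme thresholds\<close>

definition low :: "'a set" where
  "low = {w \<in> verts G - set p. thr w \<le> 2}"

definition high :: "'a set" where
  "high = {w \<in> verts G - set p. length p \<le> thr w + 2}"

lemma card_nth_image:
  assumes "J \<subseteq> {..<length p}"
  shows "card ((!) p ` J) = card J"
  using assms distinct_p by (intro card_image inj_on_nth) auto

text \<open>A vertex of \<open>low\<close> with at least average in-degree within \<open>low\<close>
  is also dominated by the k - 2 path vertices from \<open>p ! 2\<close> on; its in-degree is at
  most (n - 1 + i)/2.\<close>

lemma length_le_of_low:
  assumes "low \<noteq> {}" and part: "card (verts G) = length p + card low + card high"
  shows "int (length p) - 4 \<le> int (card high) + irregularity G"
proof -
  have sub: "low \<subseteq> verts G" by (auto simp: low_def)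
  obtain w where w: "w \<in> low" "card low \<le> 2 * card (in_nbrs w \<inter> low) + 1"
    using ex_large_in_degree_within[OF sub assms(1)] .
  let ?J = "{2..<length p}"
  have "(!) p ` ?J \<subseteq> in_nbrs w"
    using w(1) nth_dominates_iff by (auto simp: low_def)
  moreover have "(!) p ` ?J \<inter> low = {}" by (auto simp: low_def)
  ultimately have "card ((!) p ` ?J) + card (in_nbrs w \<inter> low) \<le> card (in_nbrs w)"
    by (subst card_Un_disjoint[symmetric]) (auto intro!: card_mono)
  moreover have "card ((!) p ` ?J) = length p - 2"
    by (subst card_nth_image) auto
  moreover have "2 * int (card (in_nbrs w)) \<le> int (card (verts G)) - 1 + irregularity G"
    using w(1) sub by (intro degree_bounds) auto
  ultimately show ?thesis
    using w(2) part length_ge_2 by linarith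
qed

text \<open>Dual argument: out-degrees within \<open>high\<close>, and the first k - 2 path
  vertices.\<close>

lemma length_le_of_high:
  assumes "high \<noteq> {}" and part: "card (verts G) = length p + card low + card high"
  shows "int (length p) - 4 \<le> int (card low) + irregularity G"
proof -
  have sub: "high \<subseteq> verts G" by (auto simp: high_def)
  obtain w where w: "w \<in> high" "card high \<le> 2 * card (out_nbrs w \<inter> high) + 1"
    using ex_large_out_degree_within[OF sub assms(1)] .
  let ?J = "{..<length p - 2}"
  have "(!) p ` ?J \<subseteq> out_nbrs w"
    using w(1) dominates_nth_iff by (auto simp: high_def)
  moreover have "(!) p ` ?J \<inter> high = {}" by (auto simp: high_def)
  ultimately have "card ((!) p ` ?J) + card (out_nbrs w \<inter> high) \<le> card (out_nbrs w)"
    by (subst card_Un_disjoint[symmetric]) (auto intro!: card_mono)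
  moreover have "card ((!) p ` ?J) = length p - 2"
    by (subst card_nth_image) auto
  moreover have "2 * int (card (out_nbrs w)) \<le> int (card (verts G)) - 1 + irregularity G"
    using w(1) sub by (intro degree_bounds) auto
  ultimately show ?thesis
    using w(2) part length_ge_2 by linarith
qed

text \<open>Double count 2-paths between distinct vertices of \<open>X\<close>, where |X| = m. A
  midpoint in \<open>X\<close> sees m - 1 vertices of \<open>X\<close>, each of the 4 other path
  vertices sees m, and in-degree times out-degree is at most a quarter of the square.\<close>

lemma pi2_le_of_extreme_thr:
  assumes extreme: "verts G - set p \<subseteq> low \<union> high" and k: "length p = m + 4"
  shows "pi2 G * (m * (m - 1)) \<le> m * ((m - 1)\<^sup>2 div 4) + 4 * (m\<^sup>2 div 4)"
proof -
  define X where "X = (!) p ` {2..<length p - 2}"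
  have cX: "card X = m" and finX: "finite X"
    unfolding X_def using k by (subst card_nth_image) auto
  have Xp: "X \<subseteq> set p" by (auto simp: X_def)
  then have XV: "X \<subseteq> verts G" using set_subset_verts by auto
  \<comment> \<open>An outside midpoint would have threshold above 2 and below k - 2, so it would be
    in neither \<open>low\<close> nor \<open>high\<close>.\<close>
  have inner: "out_nbrs u \<inter> in_nbrs v \<subseteq> set p" if uv: "u \<in> X" "v \<in> X" for u v
  proof
    fix z assume z: "z \<in> out_nbrs u \<inter> in_nbrs v"
    show "z \<in> set p"
    proof (rule ccontr)
      assume "z \<notin> set p"
      then have zW: "z \<in> verts G - set p" using z adj_in_verts by auto
      obtain i where i: "u = p ! i" "2 \<le> i" "i < length p - 2" using uv unfolding X_def by force
      obtain j where j: "v = p ! j" "2 \<le> j" "j < length p - 2" using uv unfolding X_def by force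
      have "thr z \<le> i" using nth_dominates_iff[OF zW, of i] z i by auto
      moreover have "j < thr z" using dominates_nth_iff[OF zW, of j] z j by auto
      ultimately show False using zW extreme i j by (auto simp: low_def high_def)
    qed
  qed
  have "pi2 G * (m * (m - 1)) = (\<Sum>u\<in>X. \<Sum>v\<in>X - {u}. pi2 G)"
    using cX finX by (simp add: card_Diff_singleton)
  also have "\<dots> \<le> (\<Sum>u\<in>X. \<Sum>v\<in>X. card (out_nbrs u \<inter> in_nbrs v \<inter> set p))"
  proof (rule sum_mono)
    fix u assume u: "u \<in> X"
    have "(\<Sum>v\<in>X - {u}. pi2 G) \<le> (\<Sum>v\<in>X - {u}. card (out_nbrs u \<inter> in_nbrs v \<inter> set p))"
    proof (rule sum_mono)
      fix v assume v: "v \<in> X - {u}"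
      then have "pi2 G \<le> card (out_nbrs u \<inter> in_nbrs v)"
        using u XV by (intro pi2_le_card) auto
      then show "pi2 G \<le> card (out_nbrs u \<inter> in_nbrs v \<inter> set p)"
        using inner[of u v] u v by (simp add: Int_absorb2)
    qed
    also have "\<dots> \<le> (\<Sum>v\<in>X. card (out_nbrs u \<inter> in_nbrs v \<inter> set p))"
      using finX by (intro sum_mono2) auto
    finally show "(\<Sum>v\<in>X - {u}. pi2 G) \<le> (\<Sum>v\<in>X. card (out_nbrs u \<inter> in_nbrs v \<inter> set p))" .
  qed
  also have "\<dots> = (\<Sum>z\<in>set p. card (in_nbrs z \<inter> X) * card (out_nbrs z \<inter> X))"
    using finX by (intro sum_two_paths) auto
  also have "\<dots> \<le> (\<Sum>z\<in>set p. (card (X - {z}))\<^sup>2 div 4)"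
  proof (rule sum_mono)
    fix z assume "z \<in> set p"
    then show "card (in_nbrs z \<inter> X) * card (out_nbrs z \<inter> X) \<le> (card (X - {z}))\<^sup>2 div 4"
      using mult_le_sum_square_div_4[of "card (in_nbrs z \<inter> X)" "card (out_nbrs z \<inter> X)"]
        card_nbrs_in_set[OF XV, of z] set_subset_verts by auto
  qed
  also have "\<dots> = (\<Sum>z\<in>X. (card (X - {z}))\<^sup>2 div 4) + (\<Sum>z\<in>set p - X. (card (X - {z}))\<^sup>2 div 4)"
    using Xp by (subst sum.subset_diff[OF Xp]) auto
  also have "(\<Sum>z\<in>X. (card (X - {z}))\<^sup>2 div 4) = m * ((m - 1)\<^sup>2 div 4)"
    using cX finX by (simp add: card_Diff_singleton)
  also have "(\<Sum>z\<in>set p - X. (card (X - {z}))\<^sup>2 div 4) = 4 * (m\<^sup>2 div 4)"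
    using cX finX Xp k distinct_p by (simp add: card_Diff_subset distinct_card)
  finally show ?thesis .
qed

end

text \<open>
  The parity information in the floors is needed only for \<open>m = 3\<close>.
\<close>

lemma extreme_thr_arith:
  fixes q m n :: nat and i :: int
  assumes count: "q * (m * (m - 1)) \<le> m * ((m - 1)\<^sup>2 div 4) + 4 * (m\<^sup>2 div 4)"
    and m: "3 \<le> m" and q: "2 \<le> q" and i: "0 \<le> i"
    and n: "3 * int m + 4 \<le> int n + 2 * i" and q12: "12 * int q \<ge> int n + 9 + 6 * i"
  shows False
proof -
  have low: "3 * int m + 13 \<le> 12 * int q" using n q12 i by linarith
  consider "m = 3" | "m = 4" | "5 \<le> m" using m by linarith
  then show False
  proof cases
    case 1
    \<comment> \<open>The count reads \<open>6 * q <= 11\<close>.\<close>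
    then show ?thesis using count q by simp
  next
    case 2
    \<comment> \<open>The count gives \<open>12 * q <= 24\<close>, whereas \<open>low\<close>
      requires 25.\<close>
    then show ?thesis using count low by simp
  next
    case 3
    \<comment> \<open>Without the floors a common factor \<open>m\<close> cancels.\<close>
    have "4 * (m * ((m - 1)\<^sup>2 div 4) + 4 * (m\<^sup>2 div 4)) \<le> m * (m - 1)\<^sup>2 + 4 * m\<^sup>2"
    proof -
      have "4 * (m * a + 4 * b) \<le> m * c + 4 * d" if "4 * a \<le> c" "4 * b \<le> d" for a b c d :: nat
      proof -
        have "4 * (m * a) \<le> m * c"
          using mult_le_mono2[OF that(1), of m] by (simp only: mult.left_commute)
        moreover have "4 * (4 * b) \<le> 4 * d"
          using that(2) by simp
        ultimately show ?thesis unfolding distrib_left by (rule add_mono)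
      qed
      then show ?thesis by simp
    qed
    then have "4 * (q * (m * (m - 1))) \<le> m * (m - 1)\<^sup>2 + 4 * m\<^sup>2"
      using mult_le_mono2[OF count, of 4] by (rule order_trans[rotated])
    moreover have "4 * (q * (m * d)) = m * (4 * q * d)" "m * d\<^sup>2 + 4 * m\<^sup>2 = m * (d\<^sup>2 + 4 * m)" for d
      by (simp_all add: algebra_simps power2_eq_square)
    ultimately have "m * (4 * q * (m - 1)) \<le> m * ((m - 1)\<^sup>2 + 4 * m)"
      by simp
    then have "4 * q * (m - 1) \<le> (m - 1)\<^sup>2 + 4 * m"
      using m by simp
    then have "int (4 * q * (m - 1)) \<le> int ((m - 1)\<^sup>2 + 4 * m)" by (simp only: zle_int)
    then have "4 * int q * (int m - 1) \<le> (int m - 1)\<^sup>2 + 4 * int m"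
      using m by (simp add: of_nat_diff)
    then have "3 * (4 * int q * (int m - 1)) \<le> 3 * ((int m - 1)\<^sup>2 + 4 * int m)"
      by (rule mult_left_mono) simp
    moreover have "(3 * int m + 13) * (int m - 1) \<le> 12 * int q * (int m - 1)"
      using low m by (intro mult_right_mono) auto
    then have "(3 * int m + 13) * (int m - 1) \<le> 3 * (4 * int q * (int m - 1))"
      by simp
    ultimately have "(3 * int m + 13) * (int m - 1) \<le> 3 * ((int m - 1)\<^sup>2 + 4 * int m)"
      by (rule order_trans[rotated])
    \<comment> \<open>Expanding leaves \<open>4 * m <= 16\<close>.\<close>
    then show False using 3 by (simp add: algebra_simps power2_eq_square)
  qed
qed

theorem theorem8:
  fixes T :: "('a, 'b) pre_digraph" and n :: nat
  assumes "tournament T"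
    and "n = card (verts T)"
    and "n \<ge> 9"
    and "real (pi2 T) > (real n - 9) / 12"
    and "real_of_int (irregularity T) < 2 * real (pi2 T) - (real n + 8) / 6"
  shows "path_extendable T"
  unfolding path_extendable_def
proof (intro allI impI, rule ccontr)
  fix p
  assume p: "vpath p T \<and> \<not> hamiltonian_path T p \<and> 1 \<le> vwalk_length p"
    and "\<not> extendable T p"
  interpret tournament T by fact
  interpret unextendable_path T p
    using p \<open>\<not> extendable T p\<close> by unfold_locales auto
  define i where "i = irregularity T"
  have "0 \<le> i"
    using irregularity_ge[of "p ! 0"] nth_in_verts[of 0] length_ge_2 unfolding i_def by linarith
  \<comment> \<open>Clearing denominators makes both sides integers, so strictness turns 8 into
    9.\<close>
  have "real_of_int (6 * i + int n + 8) < real_of_int (12 * int (pi2 T))"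
    using assms(5) by (simp add: i_def field_simps)
  then have q12: "6 * i + int n + 9 \<le> 12 * int (pi2 T)"
    by (simp only: of_int_less_iff)
  then have q: "2 \<le> pi2 T" using \<open>0 \<le> i\<close> assms(3) by linarith
  have irr: "i + 2 < 2 * int (pi2 T)" using q12 \<open>0 \<le> i\<close> assms(3) by linarith
  have len: "2 * pi2 T + 3 \<le> length p" using length_ge q by simp
  have extreme: "verts T - set p \<subseteq> low \<union> high"
  proof
    fix w assume w: "w \<in> verts T - set p"
    show "w \<in> low \<union> high"
    proof (rule ccontr)
      assume "w \<notin> low \<union> high"
      then have "3 \<le> thr w" "thr w + 3 \<le> length p"
        using w by (auto simp: low_def high_def)
      with irregularity_ge_of_middle_thr[OF _ w] irr q len show False
        by (auto simp: i_def)
    qed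
  qed
  have "low \<inter> high = {}" using len q by (auto simp: low_def high_def)
  moreover have W: "verts T - set p = low \<union> high"
    using extreme by (auto simp: low_def high_def)
  moreover have fin: "finite low" "finite high"
    unfolding low_def high_def by auto
  ultimately have part: "card (verts T) = length p + card low + card high"
    using card_verts by (simp add: card_Un_disjoint)
  have "verts T - set p \<noteq> {}"
    using p set_subset_verts by (auto simp: hamiltonian_path_def)
  then have "low \<noteq> {} \<or> high \<noteq> {}" using W by auto
  \<comment> \<open>If one class were empty, the other would give \<open>k - 4 <= i\<close>, but k -
    4 is at least \<open>2 * pi2 T - 1\<close>, which exceeds \<open>i\<close>.\<close>
  have "low \<noteq> {}"
  proof
    assume "low = {}"
    then have "int (length p) - 4 \<le> i"
      using length_le_of_high part \<open>low \<noteq> {} \<or> high \<noteq> {}\<close> by (auto simp: i_def)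
    then show False using irr len by linarith
  qed
  moreover have "high \<noteq> {}"
  proof
    assume "high = {}"
    then have "int (length p) - 4 \<le> i"
      using length_le_of_low part \<open>low \<noteq> {} \<or> high \<noteq> {}\<close> by (auto simp: i_def)
    then show False using irr len by linarith
  qed
  ultimately have "int (length p) - 4 \<le> int (card high) + i" "int (length p) - 4 \<le> int (card low) + i"
    using length_le_of_low length_le_of_high part by (auto simp: i_def)
  \<comment> \<open>Add the two bounds and use |L| + |H| = n - k.\<close>
  then have n: "3 * int (length p - 4) + 4 \<le> int n + 2 * i"
    using part assms(2) len q by linarith
  have "length p = (length p - 4) + 4" using len q by simp
  from pi2_le_of_extreme_thr[OF extreme this] show False
    by (rule extreme_thr_arith) (use len q q12 n \<open>0 \<le> i\<close> in auto)
qed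

end
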